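(* Let $n\geqslant 2$ and $k\geqslant n-2$, and let $e_i$ denote the $i$-th elementary symmetric function of $x_1,\ldots,x_{k+1}$ (with $e_0=1$). Then $$C_n(x_1,x_2,\ldots,x_{k+1})=\sum \gamma(n;i_1,i_2,\ldots,i_n)\,e_{k-n+2}^{i_n}e_{k-n+3}^{i_{n-1}}\cdots e_k^{i_2}e_{k+1}^{i_1},$$ where the summation is over all sequences $(i_1,\ldots,i_n)$ of nonnegative integers with $i_1+\cdots+i_n=n$, $1\leqslant i_1\leqslant n-1$, and $i_n\in\{0,1\}$, and where $i_n=1$ implies $i_1=n-1$. Moreover, $\gamma(n;i_1,\ldots,i_n)$ equals the number of 0-1-2-$\cdots$-$k$-$(k+1)$ increasing plane trees on $[n]$ having exactly $i_j$ vertices of degree $j-1$ for every $1\leqslant j\leqslant n$.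
   Context: $C_n(x_1,\ldots,x_{k+1})=\sum_{\sigma\in\mathcal{Q}_n(k)}x_1^{\mathrm{plat}_1(\sigma)}\cdots x_{k-1}^{\mathrm{plat}_{k-1}(\sigma)}x_k^{\mathrm{des}(\sigma)}x_{k+1}^{\mathrm{asc}(\sigma)}$, where: $\mathcal{Q}_n(k)$ is the set of $k$-Stirling permutations of order $n$, i.e. permutations $\sigma=\sigma_1\cdots\sigma_{kn}$ of the multiset $\{1^k,\ldots,n^k\}$ such that for each $i$ all entries between two occurrences of $i$ are at least $i$; with $\sigma_0=\sigma_{kn+1}=0$, an index $0\leqslant i\leqslant kn$ is an ascent/descent/plateau if $\sigma_i<\sigma_{i+1}$ / $\sigma_i>\sigma_{i+1}$ / $\sigma_i=\sigma_{i+1}$; a plateau $i$ is a $j$-plateau if exactly $j-1$ indices $\ell<i$ satisfy $\sigma_\ell=\sigma_i$; $\mathrm{asc},\mathrm{des},\mathrm{plat}_j$ count these. An increasing plane tree on $[n]$ is a rooted tree on vertex set $[n]$ with root $1$, in which the children of each vertex are linearly ordered and labels increase along every path from the root; the degree of a vertex is its number of children. A 0-1-2-$\cdots$-$m$ increasing plane tree is one in which every vertex has at most $m$ children. *)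

theory Defs
  imports Complex_Main "HOL-Library.Multiset" "HOL-Library.FuncSet"
begin

definition stirling_perms :: "nat \<Rightarrow> nat \<Rightarrow> nat list set" where
  "stirling_perms k n = {\<sigma>. mset \<sigma> = (\<Sum>i\<in>{1..n}. replicate_mset k i) \<and>
     (\<forall>a b c. a < b \<and> b < c \<and> c < length \<sigma> \<and> \<sigma> ! a = \<sigma> ! c \<longrightarrow> \<sigma> ! a \<le> \<sigma> ! b)}"

text \<open>The word bordered by zeros: \<open>entry \<sigma> i\<close> is the usual 1-based entry
  for \<open>1 \<le> i \<le> length \<sigma>\<close>, and 0 for \<open>i = 0\<close> and \<open>i = length \<sigma> + 1\<close>.\<close>

definition entry :: "nat list \<Rightarrow> nat \<Rightarrow> nat" where
  "entry \<sigma> i = (0 # \<sigma> @ [0]) ! i"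

definition asc :: "nat list \<Rightarrow> nat" where
  "asc \<sigma> = card {i. i \<le> length \<sigma> \<and> entry \<sigma> i < entry \<sigma> (i + 1)}"

definition des :: "nat list \<Rightarrow> nat" where
  "des \<sigma> = card {i. i \<le> length \<sigma> \<and> entry \<sigma> i > entry \<sigma> (i + 1)}"

definition plat :: "nat \<Rightarrow> nat list \<Rightarrow> nat" where
  "plat j \<sigma> = card {i. i \<le> length \<sigma> \<and> entry \<sigma> i = entry \<sigma> (i + 1) \<and>
     card {l. l < i \<and> entry \<sigma> l = entry \<sigma> i} = j - 1}"

text \<open>Polynomials in \<open>x\<^sub>1, \<dots>, x\<^sub>k\<^sub>+\<^sub>1\<close> are given by their values at
  arbitrary elements \<open>x j\<close> of an arbitrary commutative ring; taking the \<open>x j\<close> to be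
  the indeterminates of a polynomial ring recovers the formal polynomials.\<close>

definition stirling_poly :: "nat \<Rightarrow> nat \<Rightarrow> (nat \<Rightarrow> 'a::comm_ring_1) \<Rightarrow> 'a" where
  "stirling_poly k n x =
     (\<Sum>\<sigma>\<in>stirling_perms k n.
        (\<Prod>j\<in>{1..k - 1}. x j ^ plat j \<sigma>) * x k ^ des \<sigma> * x (k + 1) ^ asc \<sigma>)"

definition elem_sym :: "nat \<Rightarrow> nat \<Rightarrow> (nat \<Rightarrow> 'a::comm_ring_1) \<Rightarrow> 'a" where
  "elem_sym m i x = (\<Sum>S | S \<subseteq> {1..m} \<and> card S = i. \<Prod>j\<in>S. x j)"

text \<open>Rooted plane trees with labelled vertices; the list order of the subtrees is the
  linear order on the children.\<close>

datatype ptree = Node (label: nat) (children: "ptree list")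

primrec labels :: "ptree \<Rightarrow> nat list" where
  "labels (Node a ts) = a # concat (map labels ts)"

primrec degrees :: "ptree \<Rightarrow> nat list" where
  "degrees (Node a ts) = length ts # concat (map degrees ts)"

fun increasing :: "ptree \<Rightarrow> bool" where
  "increasing (Node a ts) \<longleftrightarrow> (\<forall>t\<in>set ts. a < label t \<and> increasing t)"

definition increasing_plane_tree :: "nat \<Rightarrow> ptree \<Rightarrow> bool" where
  "increasing_plane_tree n t \<longleftrightarrow>
     distinct (labels t) \<and> set (labels t) = {1..n} \<and> label t = 1 \<and> increasing t"

definition degree_bounded :: "nat \<Rightarrow> ptree \<Rightarrow> bool" where
  "degree_bounded m t \<longleftrightarrow> (\<forall>d\<in>set (degrees t). d \<le> m)"

definition tree_gamma :: "nat \<Rightarrow> nat \<Rightarrow> (nat \<Rightarrow> nat) \<Rightarrow> nat" where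
  "tree_gamma k n i = card {t. increasing_plane_tree n t \<and> degree_bounded (k + 1) t \<and>
     (\<forall>j\<in>{1..n}. count_list (degrees t) (j - 1) = i j)}"

definition gamma_index :: "nat \<Rightarrow> (nat \<Rightarrow> nat) set" where
  "gamma_index n = {i \<in> {1..n} \<rightarrow>\<^sub>E UNIV. (\<Sum>j\<in>{1..n}. i j) = n \<and>
     1 \<le> i 1 \<and> i 1 \<le> n - 1 \<and> i n \<in> {0, 1} \<and> (i n = 1 \<longrightarrow> i 1 = n - 1)}"

end

theory Submission imports Defs "HOL-Computational_Algebra.Formal_Power_Series" begin

text \<open>
  Let \<open>D\<close> be the sum of the partial derivatives with respect to \<open>x\<^sub>1, \<dots>, x\<^sub>k\<^sub>+\<^sub>1\<close>. Inserting the
  block of \<open>k\<close> copies of \<open>n + 1\<close> into a gap of a Stirling permutation replaces the variable of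
  that gap by \<open>x\<^sub>1 \<cdots> x\<^sub>k\<^sub>+\<^sub>1\<close>, so \<open>C\<^sub>n\<^sub>+\<^sub>1 = e\<^sub>k\<^sub>+\<^sub>1 * D C\<^sub>n\<close>. On the other hand
  \<open>D e\<^sub>k\<^sub>+\<^sub>1\<^sub>-\<^sub>d = (d + 1) * e\<^sub>k\<^sub>-\<^sub>d\<close>: giving a vertex of degree \<open>d\<close> the weight \<open>e\<^sub>k\<^sub>+\<^sub>1\<^sub>-\<^sub>d\<close>, the
  operator \<open>e\<^sub>k\<^sub>+\<^sub>1 * D\<close> attaches a new leaf to some vertex in one of the \<open>d + 1\<close> possible
  places. So both sides obey the same recurrence. Over an arbitrary commutative ring, \<open>D\<close> is
  realised as the derivative of formal power series in \<open>t\<close> at the points \<open>x\<^sub>j + t\<close>.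
\<close>

subsection \<open>Increasing plane trees\<close>

lemma fps_deriv_prod:
  fixes f :: "'b \<Rightarrow> 'a::comm_ring_1 fps"
  assumes "finite A"
  shows "fps_deriv (prod f A) = (\<Sum>a\<in>A. fps_deriv (f a) * prod f (A - {a}))"
  using assms
proof (induction A rule: finite_induct)
  case (insert b A)
  have "fps_deriv (f a) * prod f (insert b A - {a}) = f b * (fps_deriv (f a) * prod f (A - {a}))"
    if "a \<in> A" for a
  proof -
    have "insert b A - {a} = insert b (A - {a})" "b \<notin> A - {a}" "finite (A - {a})"
      using that insert.hyps by auto
    then show ?thesis by (simp add: mult_ac)
  qed
  moreover have "insert b A - {b} = A" using insert.hyps by auto
  ultimately show ?case
    using insert by (simp add: sum_distrib_left algebra_simps)
qed simp

lemma fps_deriv_prod_list: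
  fixes xs :: "'a::comm_ring_1 fps list"
  shows "fps_deriv (prod_list xs) =
    (\<Sum>q<length xs. fps_deriv (xs ! q) * (prod_list (take q xs) * prod_list (drop (Suc q) xs)))"
proof (induction xs)
  case (Cons a xs)
  then show ?case
    by (simp add: sum.lessThan_Suc_shift sum_distrib_left algebra_simps del: sum.lessThan_Suc)
qed simp

text \<open>Double counting: deleting \<open>s\<close> from a set of size \<open>i + 1\<close>
  leaves a set of size \<open>i\<close>, and each such set arises once from each of the
  \<open>m - i\<close> elements outside it.\<close>

lemma fps_deriv_elem_sym_Suc:
  fixes X :: "nat \<Rightarrow> 'a::comm_ring_1 fps"
  assumes X: "\<And>j. fps_deriv (X j) = 1"
  shows "fps_deriv (elem_sym m (Suc i) X) = of_nat (m - i) * elem_sym m i X"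
proof -
  let ?F = "\<lambda>i. {S. S \<subseteq> {1..m} \<and> card S = i}"
  have finS: "finite S" if "S \<subseteq> {Suc 0..m}" for S
    using that finite_subset by blast
  have "fps_deriv (elem_sym m (Suc i) X) = (\<Sum>S\<in>?F (Suc i). fps_deriv (prod X S))"
    by (simp add: elem_sym_def fps_deriv_sum)
  also have "\<dots> = (\<Sum>S\<in>?F (Suc i). \<Sum>s\<in>S. prod X (S - {s}))"
    by (intro sum.cong refl) (simp add: fps_deriv_prod finS X)
  also have "\<dots> = (\<Sum>(S, s)\<in>(SIGMA S:?F (Suc i). S). prod X (S - {s}))"
    by (rule sum.Sigma) (auto intro: finS)
  also have "\<dots> = (\<Sum>(S, s)\<in>(SIGMA S:?F i. {1..m} - S). prod X S)"
    by (rule sum.reindex_bij_witness[where i = "\<lambda>(S, s). (insert s S, s)"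
          and j = "\<lambda>(S, s). (S - {s}, s)"])
       (auto simp: insert_absorb finS)
  also have "\<dots> = (\<Sum>S\<in>?F i. \<Sum>s\<in>{1..m} - S. prod X S)"
    by (rule sum.Sigma[symmetric]) auto
  also have "\<dots> = (\<Sum>S\<in>?F i. of_nat (m - i) * prod X S)"
    by (intro sum.cong refl) (auto simp: card_Diff_subset finS)
  finally show ?thesis by (simp add: elem_sym_def sum_distrib_left)
qed

text \<open>The weight of a vertex of degree \<open>d\<close>; the zero for \<open>d > k + 1\<close> both encodes the
  degree bound and makes the derivative rule below hold without side condition.\<close>

definition vertex_weight :: "nat \<Rightarrow> (nat \<Rightarrow> 'a::comm_ring_1) \<Rightarrow> nat \<Rightarrow> 'a" where
  "vertex_weight k x d = (if d \<le> k + 1 then elem_sym (k + 1) (k + 1 - d) x else 0)"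

text \<open>The factor \<open>Suc d\<close> will be the number of places for a new child among
  \<open>d\<close> ordered children.\<close>

lemma fps_deriv_vertex_weight:
  fixes X :: "nat \<Rightarrow> 'a::comm_ring_1 fps"
  assumes X: "\<And>j. fps_deriv (X j) = 1"
  shows "fps_deriv (vertex_weight k X d) = of_nat (Suc d) * vertex_weight k X (Suc d)"
proof -
  \<comment> \<open>At \<open>d = k + 1\<close> the weight is e_0 = 1, whose derivative vanishes
    just as the weight of degree \<open>Suc d\<close> does.\<close>
  consider "d \<le> k" | "d = k + 1" | "d > k + 1" by linarith
  then show ?thesis
  proof cases
    case 1
    then have "k + 1 - d = Suc (k - d)" "k + 1 - (k - d) = Suc d" by auto
    then show ?thesis
      using 1 fps_deriv_elem_sym_Suc[of X "k + 1" "k - d", OF X]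
      by (simp add: vertex_weight_def)
  next
    case 2
    have "{S. S \<subseteq> {1..k + 1} \<and> card S = 0} = {{}}"
      by (auto dest: finite_subset[OF _ finite_atLeastAtMost])
    then show ?thesis using 2 by (simp add: vertex_weight_def elem_sym_def)
  qed (simp add: vertex_weight_def)
qed

lemma vertex_weight_0: "vertex_weight k x 0 = (\<Prod>j\<in>{1..k + 1}. x j)"
proof -
  have "{S. S \<subseteq> {1..k + 1} \<and> card S = k + 1} = {{1..k + 1}}"
    using card_subset_eq[of "{1..k + 1}"] by auto
  then show ?thesis by (simp add: vertex_weight_def elem_sym_def)
qed

section \<open>Weights of trees and the attachment of a new leaf\<close>

definition tree_weight :: "nat \<Rightarrow> (nat \<Rightarrow> 'a::comm_ring_1) \<Rightarrow> ptree \<Rightarrow> 'a" where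
  "tree_weight k x t = prod_list (map (vertex_weight k x) (degrees t))"

lemma prod_list_concat: "prod_list (concat xss) = prod_list (map prod_list xss)"
  by (induction xss) auto

lemma tree_weight_Node:
  "tree_weight k x (Node a ts) = vertex_weight k x (length ts) * prod_list (map (tree_weight k x) ts)"
  by (simp add: tree_weight_def prod_list_concat map_concat o_def tree_weight_def[abs_def])

text \<open>The new leaf becomes a child of the root or goes into one of the subtrees. The recursive
  call passes through \<open>map\<close>, as primitive recursion on the nested type demands.\<close>

primrec attach_leaf :: "nat \<Rightarrow> ptree \<Rightarrow> ptree set" where
  "attach_leaf m (Node a ts) =
     (\<lambda>p. Node a (take p ts @ Node m [] # drop p ts)) ` {..length ts} \<union>
     (\<Union>q<length ts. (\<lambda>t. Node a (ts[q := t])) ` (map (attach_leaf m) ts ! q))"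

lemma finite_attach_leaf: "finite (attach_leaf m t)"
  by (induction t) auto

lemma attach_leafE:
  assumes "t' \<in> attach_leaf m (Node a ts)"
  obtains (root) us vs where "ts = us @ vs" "t' = Node a (us @ Node m [] # vs)"
  | (deep) us s s' vs where "ts = us @ s # vs" "t' = Node a (us @ s' # vs)" "s' \<in> attach_leaf m s"
proof -
  consider p where "t' = Node a (take p ts @ Node m [] # drop p ts)"
    | q s' where "q < length ts" "s' \<in> attach_leaf m (ts ! q)" "t' = Node a (ts[q := s'])"
    using assms by auto
  then show thesis
  proof cases
    case 1
    then show ?thesis using root[of "take p ts" "drop p ts"] by simp
  next
    case 2
    then show ?thesis
      using deep[of "take q ts" "ts ! q" "drop (Suc q) ts" s']
      by (simp add: id_take_nth_drop[symmetric] upd_conv_take_nth_drop)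
  qed
qed

lemma attach_leaf_rootI: "Node a (us @ Node m [] # vs) \<in> attach_leaf m (Node a (us @ vs))"
  by (auto intro!: image_eqI[of _ _ "length us"])

lemma attach_leaf_deepI:
  "s' \<in> attach_leaf m s \<Longrightarrow> Node a (us @ s' # vs) \<in> attach_leaf m (Node a (us @ s # vs))"
  by (auto intro!: bexI[of _ "length us"] simp: nth_append)

lemma mset_labels_attach_leaf:
  "t' \<in> attach_leaf m t \<Longrightarrow> mset (labels t') = add_mset m (mset (labels t))"
proof (induction t arbitrary: t')
  case (Node a ts)
  from Node.prems show ?case
    by (cases rule: attach_leafE) (use Node.IH in auto)
qed

lemma set_labels_attach_leaf:
  "t' \<in> attach_leaf m t \<Longrightarrow> set (labels t') = insert m (set (labels t))"
  using mset_labels_attach_leaf[of t' m t] by (metis set_mset_add_mset_insert set_mset_mset)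

lemma label_attach_leaf: "t' \<in> attach_leaf m t \<Longrightarrow> label t' = label t"
  by (cases t) auto

lemma label_in_labels: "label t \<in> set (labels t)"
  by (cases t) simp

lemma increasing_attach_leaf:
  "t' \<in> attach_leaf m t \<Longrightarrow> increasing t \<Longrightarrow> \<forall>l\<in>set (labels t). l < m \<Longrightarrow> increasing t'"
proof (induction t arbitrary: t')
  case (Node a ts)
  from Node.prems(1) show ?case
    by (cases rule: attach_leafE) (use Node.IH Node.prems label_attach_leaf in \<open>auto simp: ball_Un\<close>)
qed

text \<open>The greatest label sits on a leaf, because children carry larger labels. That leaf is
  found by descending into a subtree containing \<open>m\<close>, and is deleted.\<close>

lemma increasing_remove_leaf:
  assumes "increasing t'" "\<forall>l\<in>set (labels t'). l \<le> m" "m \<in> set (labels t')" "label t' \<noteq> m"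
  shows "\<exists>t. increasing t \<and> t' \<in> attach_leaf m t"
  using assms
proof (induction t')
  case (Node a ts)
  then obtain s where s: "s \<in> set ts" "m \<in> set (labels s)" by auto
  then obtain us vs where ts: "ts = us @ s # vs" by (meson split_list)
  show ?case
  proof (cases "label s = m")
    case True
    obtain ss where ss: "s = Node m ss" using True by (cases s) auto
    have "ss = []"
    proof (rule ccontr)
      assume "ss \<noteq> []"
      then obtain r where "r \<in> set ss" by (cases ss) auto
      then have "m < label r" "label r \<in> set (labels s)"
        using Node.prems(1) ss ts label_in_labels[of r] by auto
      then show False using Node.prems(2) s(1) by force
    qed
    then have "Node a ts \<in> attach_leaf m (Node a (us @ vs))"
      using ss ts attach_leaf_rootI by simp
    moreover have "increasing (Node a (us @ vs))" using Node.prems(1) ts by auto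
    ultimately show ?thesis by blast
  next
    case False
    then obtain r where r: "increasing r" "s \<in> attach_leaf m r"
      using Node.IH[OF s(1)] Node.prems s ts by auto
    then have "Node a ts \<in> attach_leaf m (Node a (us @ r # vs))"
      using ts attach_leaf_deepI by simp
    moreover have "increasing (Node a (us @ r # vs))"
      using Node.prems(1) ts r label_attach_leaf[OF r(2)] by auto
    ultimately show ?thesis by blast
  qed
qed

text \<open>As \<open>n \<ge> 1\<close>, the vertex \<open>Suc n\<close> is not the root, so it is a
  leaf that can be removed. Comparing the multisets of labels transfers distinctness and range in
  both directions.\<close>

lemma increasing_plane_tree_Suc_iff:
  assumes "n \<ge> 1"
  shows "increasing_plane_tree (Suc n) t' \<longleftrightarrow>
    (\<exists>t. increasing_plane_tree n t \<and> t' \<in> attach_leaf (Suc n) t)"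
proof
  assume t': "increasing_plane_tree (Suc n) t'"
  then obtain t where t: "increasing t" "t' \<in> attach_leaf (Suc n) t"
    using increasing_remove_leaf[of t' "Suc n"] assms
    by (auto simp: increasing_plane_tree_def)
  have m: "mset (Suc n # labels t) = mset (labels t')"
    using mset_labels_attach_leaf[OF t(2)] by simp
  have d: "distinct (Suc n # labels t)"
    using mset_eq_imp_distinct_iff[OF m] t' by (simp add: increasing_plane_tree_def)
  have "set (Suc n # labels t) = {1..Suc n}"
    using mset_eq_setD[OF m] t' by (simp add: increasing_plane_tree_def)
  then have "set (labels t) = {1..Suc n} - {Suc n}" using d by auto
  also have "\<dots> = {1..n}" by auto
  finally have "set (labels t) = {1..n}" .
  then show "\<exists>t. increasing_plane_tree n t \<and> t' \<in> attach_leaf (Suc n) t"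
    using t d t' label_attach_leaf[OF t(2)] unfolding increasing_plane_tree_def by auto
next
  assume "\<exists>t. increasing_plane_tree n t \<and> t' \<in> attach_leaf (Suc n) t"
  then obtain t where t: "increasing_plane_tree n t" "t' \<in> attach_leaf (Suc n) t" by blast
  have m: "mset (Suc n # labels t) = mset (labels t')"
    using mset_labels_attach_leaf[OF t(2)] by simp
  have d: "distinct (Suc n # labels t)" using t(1) by (auto simp: increasing_plane_tree_def)
  then have "distinct (labels t')" using mset_eq_imp_distinct_iff[OF m] by simp
  moreover have "set (labels t') = {1..Suc n}"
    using set_labels_attach_leaf[OF t(2)] t(1) by (auto simp: increasing_plane_tree_def)
  moreover have "increasing t'"
    using increasing_attach_leaf[OF t(2)] t(1) by (auto simp: increasing_plane_tree_def)
  ultimately show "increasing_plane_tree (Suc n) t'"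
    using label_attach_leaf[OF t(2)] t(1) by (auto simp: increasing_plane_tree_def)
qed

text \<open>A left inverse of \<open>attach_leaf\<close>, showing that different trees grow into
  different trees. Each child is paired with its image so that the filter tests the label of the
  original child while the recursion still passes through \<open>map\<close>.\<close>

primrec remove_leaf :: "nat \<Rightarrow> ptree \<Rightarrow> ptree" where
  "remove_leaf m (Node a ts) =
     Node a (map snd (filter (\<lambda>(s, _). label s \<noteq> m) (map (\<lambda>s. (s, remove_leaf m s)) ts)))"

lemma remove_leaf_absent: "m \<notin> set (labels t) \<Longrightarrow> remove_leaf m t = t"
proof (induction t)
  case (Node a ts)
  have "\<forall>s\<in>set ts. label s \<noteq> m" using Node.prems label_in_labels by fastforce
  moreover have "\<forall>s\<in>set ts. remove_leaf m s = s" using Node by auto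
  ultimately show ?case
    by (simp add: filter_map o_def map_idI)
qed

lemma remove_leaf_attach_leaf:
  "t' \<in> attach_leaf m t \<Longrightarrow> m \<notin> set (labels t) \<Longrightarrow> remove_leaf m t' = t"
proof (induction t arbitrary: t')
  case (Node a ts)
  have 1: "\<forall>s\<in>set ts. label s \<noteq> m" using Node.prems label_in_labels by fastforce
  have 2: "\<forall>s\<in>set ts. remove_leaf m s = s" using Node.prems by (auto intro: remove_leaf_absent)
  from Node.prems(1) show ?case
  proof (cases rule: attach_leafE)
    case (root us vs)
    then show ?thesis using 1 2 by (simp add: filter_map o_def map_idI)
  next
    case (deep us s s' vs)
    have "remove_leaf m s' = s" using Node deep by auto
    moreover have "label s' \<noteq> m" using deep 1 label_attach_leaf by auto
    ultimately show ?thesis using deep 1 2 by (simp add: filter_map o_def map_idI)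
  qed
qed

text \<open>Leibniz rule for the product of the weights: the root factor accounts for the leaves
  attached at the root, each subtree factor for the leaves inside that subtree, by induction.
  Absence of \<open>m\<close> from \<open>t\<close> keeps the resulting trees distinct.\<close>

lemma sum_tree_weight_attach_leaf:
  fixes X :: "nat \<Rightarrow> 'a::comm_ring_1 fps"
  assumes X: "\<And>j. fps_deriv (X j) = 1"
  shows "m \<notin> set (labels t) \<Longrightarrow>
    (\<Sum>t'\<in>attach_leaf m t. tree_weight k X t') = vertex_weight k X 0 * fps_deriv (tree_weight k X t)"
proof (induction t)
  case (Node a ts)
  let ?E = "vertex_weight k X" and ?W = "tree_weight k X"
  let ?f = "\<lambda>p. Node a (take p ts @ Node m [] # drop p ts)"
  let ?A = "?f ` {..length ts}"
  let ?B = "\<lambda>q. (\<lambda>t. Node a (ts[q := t])) ` attach_leaf m (ts ! q)"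
  let ?R = "\<lambda>q. prod_list (map ?W (take q ts)) * prod_list (map ?W (drop (Suc q) ts))"
  have notin: "m \<notin> set (labels s)" if "s \<in> set ts" for s
    using Node.prems that by auto
  have lab: "label s \<noteq> m" if "s \<in> set ts" for s
    using notin[OF that] label_in_labels[of s] by auto
  \<comment> \<open>The position of the new leaf is the number of children before the first one
    labelled \<open>m\<close>.\<close>
  have injA: "inj_on ?f {..length ts}"
  proof (rule inj_on_inverseI[where g = "\<lambda>t. length (takeWhile (\<lambda>s. label s \<noteq> m) (children t))"])
    fix p assume p: "p \<in> {..length ts}"
    have "takeWhile (\<lambda>s. label s \<noteq> m) (take p ts @ Node m [] # drop p ts) = take p ts"
      using lab by (subst takeWhile_append2) (auto dest: in_set_takeD)
    then show "length (takeWhile (\<lambda>s. label s \<noteq> m) (children (?f p))) = p"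
      using p by simp
  qed
  have injB: "inj_on (\<lambda>t. Node a (ts[q := t])) S" if "q < length ts" for q S
    by (rule inj_on_inverseI[where g = "\<lambda>t. children t ! q"]) (use that in simp)
  \<comment> \<open>A leaf at the root raises the root degree by one; a deeper leaf keeps
    it.\<close>
  have disjA: "?A \<inter> (\<Union>q<length ts. ?B q) = {}"
  proof -
    have "length (children t) = Suc (length ts)" if "t \<in> ?A" for t using that by auto
    moreover have "length (children t) = length ts" if "t \<in> (\<Union>q<length ts. ?B q)" for t
      using that by auto
    ultimately show ?thesis by fastforce
  qed
  \<comment> \<open>The label \<open>m\<close> reveals which subtree was changed.\<close>
  have disjB: "?B q \<inter> ?B r = {}" if "q < length ts" "r < length ts" "q \<noteq> r" for q r
  proof -
    have "m \<in> set (labels (children t ! q))" if "t \<in> ?B q" for t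
      using that \<open>q < length ts\<close> set_labels_attach_leaf by auto
    moreover have "m \<notin> set (labels (children t ! q))" if "t \<in> ?B r" for t
      using that \<open>q < length ts\<close> \<open>q \<noteq> r\<close> notin by auto
    ultimately show ?thesis by blast
  qed
  have "sum ?W (attach_leaf m (Node a ts)) = sum ?W (?A \<union> (\<Union>q<length ts. ?B q))"
    by simp
  also have "\<dots> = sum ?W ?A + sum ?W (\<Union>q<length ts. ?B q)"
    by (rule sum.union_disjoint) (use disjA in \<open>auto simp: finite_attach_leaf\<close>)
  also have "sum ?W ?A = (\<Sum>p\<le>length ts. ?W (?f p))"
    by (subst sum.reindex[OF injA]) simp
  also have "\<dots> = (\<Sum>p\<le>length ts. ?E 0 * ?E (Suc (length ts)) * prod_list (map ?W ts))"
  proof (rule sum.cong)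
    fix p
    have "prod_list (map ?W ts) = prod_list (map ?W (take p ts)) * prod_list (map ?W (drop p ts))"
      by (metis append_take_drop_id map_append prod_list.append)
    then show "p \<in> {..length ts} \<Longrightarrow> ?W (?f p) = ?E 0 * ?E (Suc (length ts)) * prod_list (map ?W ts)"
      by (simp add: tree_weight_Node mult_ac)
  qed simp
  \<comment> \<open>The \<open>length ts + 1\<close> equal terms supply the factor in the derivative
    of the root weight.\<close>
  also have "\<dots> = ?E 0 * fps_deriv (?E (length ts)) * prod_list (map ?W ts)"
    by (simp add: fps_deriv_vertex_weight[OF X] algebra_simps)
  also have "sum ?W (\<Union>q<length ts. ?B q) = (\<Sum>q<length ts. sum ?W (?B q))"
    by (rule sum.UNION_disjoint) (use disjB in \<open>auto simp: finite_attach_leaf\<close>)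
  also have "\<dots> = (\<Sum>q<length ts. ?E 0 * ?E (length ts) * (fps_deriv (?W (ts ! q)) * ?R q))"
  proof (rule sum.cong)
    fix q assume "q \<in> {..<length ts}"
    then have q: "q < length ts" by simp
    have "sum ?W (?B q) = (\<Sum>t\<in>attach_leaf m (ts ! q). ?W (Node a (ts[q := t])))"
      by (subst sum.reindex[OF injB[OF q]]) simp
    also have "\<dots> = (\<Sum>t\<in>attach_leaf m (ts ! q). ?E (length ts) * ?R q * ?W t)"
    proof (intro sum.cong refl)
      fix t
      have "prod_list (map ?W (ts[q := t])) = ?R q * ?W t"
        using q by (simp add: upd_conv_take_nth_drop mult_ac)
      then show "?W (Node a (ts[q := t])) = ?E (length ts) * ?R q * ?W t"
        by (simp add: tree_weight_Node mult_ac)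
    qed
    also have "\<dots> = ?E (length ts) * ?R q * (?E 0 * fps_deriv (?W (ts ! q)))"
      using Node.IH[of "ts ! q"] q notin by (simp add: sum_distrib_left[symmetric])
    finally show "sum ?W (?B q) = ?E 0 * ?E (length ts) * (fps_deriv (?W (ts ! q)) * ?R q)"
      by (simp add: mult_ac)
  qed simp
  also have "\<dots> = ?E 0 * ?E (length ts) * fps_deriv (prod_list (map ?W ts))"
    by (simp add: fps_deriv_prod_list sum_distrib_left take_map drop_map)
  finally show ?case by (simp add: tree_weight_Node algebra_simps)
qed

section \<open>The recurrence for the tree polynomial\<close>

definition tree_poly :: "nat \<Rightarrow> nat \<Rightarrow> (nat \<Rightarrow> 'a::comm_ring_1) \<Rightarrow> 'a" where
  "tree_poly k n x = (\<Sum>t | increasing_plane_tree n t. tree_weight k x t)"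

lemma increasing_plane_tree_1: "{t. increasing_plane_tree 1 t} = {Node 1 []}"
proof -
  have "t = Node 1 []" if "increasing_plane_tree 1 t" for t
  proof (cases t)
    case (Node a ts)
    have "ts = []"
    proof (rule ccontr)
      assume "ts \<noteq> []"
      then obtain s where s: "s \<in> set ts" by (cases ts) auto
      have "label s \<in> set (labels t)" using s Node label_in_labels[of s] by auto
      then show False
        using that Node s by (auto simp: increasing_plane_tree_def)
    qed
    then show ?thesis using that Node by (simp add: increasing_plane_tree_def)
  qed
  moreover have "increasing_plane_tree 1 (Node 1 [])" by (simp add: increasing_plane_tree_def)
  ultimately show ?thesis by blast
qed

lemma increasing_plane_tree_Suc:
  "n \<ge> 1 \<Longrightarrow> {t. increasing_plane_tree (Suc n) t} =
    (\<Union>t\<in>{t. increasing_plane_tree n t}. attach_leaf (Suc n) t)"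
  using increasing_plane_tree_Suc_iff by blast

lemma finite_increasing_plane_tree: "n \<ge> 1 \<Longrightarrow> finite {t. increasing_plane_tree n t}"
proof (induction n rule: dec_induct)
  case base
  then show ?case by (simp only: increasing_plane_tree_1) simp
next
  case (step n)
  then show ?case using increasing_plane_tree_Suc[of n] finite_attach_leaf by simp
qed

lemma tree_poly_1: "tree_poly k 1 x = vertex_weight k x 0"
  unfolding tree_poly_def increasing_plane_tree_1 by (simp add: tree_weight_def)

lemma tree_poly_Suc:
  fixes X :: "nat \<Rightarrow> 'a::comm_ring_1 fps"
  assumes X: "\<And>j. fps_deriv (X j) = 1" and n: "n \<ge> 1"
  shows "tree_poly k (Suc n) X = vertex_weight k X 0 * fps_deriv (tree_poly k n X)"
proof -
  have notin: "Suc n \<notin> set (labels t)" if "increasing_plane_tree n t" for t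
    using that by (auto simp: increasing_plane_tree_def)
  have "tree_poly k (Suc n) X =
      (\<Sum>t | increasing_plane_tree n t. \<Sum>t'\<in>attach_leaf (Suc n) t. tree_weight k X t')"
    unfolding tree_poly_def increasing_plane_tree_Suc[OF n]
  proof (rule sum.UNION_disjoint)
    show "\<forall>t\<in>{t. increasing_plane_tree n t}. \<forall>s\<in>{t. increasing_plane_tree n t}.
        t \<noteq> s \<longrightarrow> attach_leaf (Suc n) t \<inter> attach_leaf (Suc n) s = {}"
      using notin remove_leaf_attach_leaf by blast
  qed (use n in \<open>auto simp: finite_attach_leaf finite_increasing_plane_tree\<close>)
  then show ?thesis
    using notin sum_tree_weight_attach_leaf[OF X]
    by (simp add: tree_poly_def fps_deriv_sum sum_distrib_left)
qed

subsection \<open>Stirling permutations\<close>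

text \<open>Generalised Stirling condition for a factor \<open>xs\<close> of a word, where \<open>U\<close> and \<open>V\<close> are the
  sets of letters occurring before and after the factor.\<close>

primrec stirling_factor :: "nat set \<Rightarrow> nat set \<Rightarrow> nat list \<Rightarrow> bool" where
  "stirling_factor U V [] \<longleftrightarrow> True"
| "stirling_factor U V (b # xs) \<longleftrightarrow>
     (\<forall>a\<in>U \<inter> (set xs \<union> V). a \<le> b) \<and> stirling_factor (insert b U) V xs"

text \<open>The purpose of the context sets \<open>U\<close> and \<open>V\<close>: with them the
  condition splits over concatenation.\<close>

lemma stirling_factor_append:
  "stirling_factor U V (xs @ ys) \<longleftrightarrow>
    stirling_factor U (set ys \<union> V) xs \<and> stirling_factor (U \<union> set xs) V ys"
  by (induction xs arbitrary: U) (auto simp: Un_ac)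

text \<open>A later \<open>m\<close> imposes a condition only if \<open>m\<close> also occurs
  earlier, which is excluded.\<close>

lemma stirling_factor_insert_after:
  "m \<notin> U \<union> set xs \<Longrightarrow> stirling_factor U (insert m V) xs = stirling_factor U V xs"
  by (induction xs arbitrary: U) auto

lemma stirling_factor_insert_before:
  "m \<notin> V \<union> set xs \<Longrightarrow> stirling_factor (insert m U) V xs = stirling_factor U V xs"
proof (induction xs arbitrary: U)
  case (Cons b xs)
  then have "stirling_factor (insert m (insert b U)) V xs = stirling_factor (insert b U) V xs"
    by auto
  then show ?case using Cons.prems by (auto simp: insert_commute)
qed simp

lemma stirling_factor_replicate:
  "\<forall>a\<in>U. a \<le> m \<Longrightarrow> stirling_factor U V (replicate k m)"
  by (induction k arbitrary: U) auto

text \<open>Between two copies of \<open>m\<close> there are only copies of \<open>m\<close>, and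
  between two equal smaller letters the block is too large to violate the condition.\<close>

lemma stirling_factor_insert_block:
  assumes "\<forall>a\<in>set xs \<union> set ys. a < m"
  shows "stirling_factor {} {} (xs @ replicate k m @ ys) \<longleftrightarrow> stirling_factor {} {} (xs @ ys)"
proof (cases "k = 0")
  case False
  have "stirling_factor (set xs) (set ys) (replicate k m)"
    using assms by (intro stirling_factor_replicate) (auto intro: less_imp_le)
  moreover have "m \<notin> set xs" "m \<notin> set ys" using assms by auto
  ultimately show ?thesis
    using False
    by (simp add: stirling_factor_append stirling_factor_insert_after stirling_factor_insert_before)
qed simp

lemma stirling_factor_nth:
  "stirling_factor U V xs \<longleftrightarrow>
    (\<forall>b<length xs. \<forall>a\<in>(U \<union> set (take b xs)) \<inter> (set (drop (Suc b) xs) \<union> V). a \<le> xs ! b)"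
  by (induction xs arbitrary: U) (simp_all add: All_less_Suc2)

lemma stirling_factor_iff:
  "stirling_factor {} {} xs \<longleftrightarrow>
    (\<forall>a b c. a < b \<and> b < c \<and> c < length xs \<and> xs ! a = xs ! c \<longrightarrow> xs ! a \<le> xs ! b)"
proof
  assume L: "stirling_factor {} {} xs"
  show "\<forall>a b c. a < b \<and> b < c \<and> c < length xs \<and> xs ! a = xs ! c \<longrightarrow> xs ! a \<le> xs ! b"
  proof (intro allI impI)
    fix a b c assume H: "a < b \<and> b < c \<and> c < length xs \<and> xs ! a = xs ! c"
    then have "xs ! a \<in> set (take b xs)"
      by (auto simp: in_set_conv_nth intro!: exI[of _ a])
    moreover have "xs ! c \<in> set (drop (Suc b) xs)"
      using H by (auto simp: in_set_conv_nth intro!: exI[of _ "c - Suc b"])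
    ultimately show "xs ! a \<le> xs ! b" using L H by (auto simp: stirling_factor_nth)
  qed
next
  assume R: "\<forall>a b c. a < b \<and> b < c \<and> c < length xs \<and> xs ! a = xs ! c \<longrightarrow> xs ! a \<le> xs ! b"
  show "stirling_factor {} {} xs"
    unfolding stirling_factor_nth
  proof (intro allI impI ballI)
    fix b v assume b: "b < length xs"
      and v: "v \<in> ({} \<union> set (take b xs)) \<inter> (set (drop (Suc b) xs) \<union> {})"
    then obtain a where a: "a < b" "xs ! a = v" by (auto simp: in_set_conv_nth)
    obtain c where c: "c < length xs - Suc b" "drop (Suc b) xs ! c = v"
      using v by (auto simp: in_set_conv_nth)
    have "xs ! (Suc b + c) = v" using c b by (simp add: nth_drop)
    then show "v \<le> xs ! b"
      using R[rule_format, of a b "Suc b + c"] a b c by auto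
  qed
qed

lemma stirling_perms_iff:
  "\<sigma> \<in> stirling_perms k n \<longleftrightarrow>
    mset \<sigma> = (\<Sum>i\<in>{1..n}. replicate_mset k i) \<and> stirling_factor {} {} \<sigma>"
  by (simp add: stirling_perms_def stirling_factor_iff)

lemma count_stirling_perms:
  "\<sigma> \<in> stirling_perms k n \<Longrightarrow> count (mset \<sigma>) c = (if c \<in> {1..n} then k else 0)"
  by (simp add: stirling_perms_def count_sum)

lemma set_stirling_perms: "\<sigma> \<in> stirling_perms k n \<Longrightarrow> set \<sigma> \<subseteq> {1..n}"
  using count_stirling_perms[of \<sigma> k n] by (metis count_mset_0_iff subsetI)

lemma finite_stirling_perms: "finite (stirling_perms k n)"
proof (rule finite_subset)
  let ?M = "\<Sum>i\<in>{1..n}. replicate_mset k i"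
  show "stirling_perms k n \<subseteq> {\<sigma>. set \<sigma> \<subseteq> {1..n} \<and> length \<sigma> = size ?M}"
    using set_stirling_perms by (auto simp: stirling_perms_def simp flip: size_mset)
qed (simp add: finite_lists_length_eq)

text \<open>Since the copies of the largest letter are contiguous, a Stirling permutation of order
  \<open>n + 1\<close> is one of order \<open>n\<close> with the block of these copies inserted at some place.\<close>

lemma bij_betw_insert_block:
  assumes "k \<ge> 1"
  shows "bij_betw (\<lambda>(\<sigma>, i). take i \<sigma> @ replicate k (Suc n) @ drop i \<sigma>)
    (SIGMA \<sigma>:stirling_perms k n. {..length \<sigma>}) (stirling_perms k (Suc n))"
    (is "bij_betw ?f ?A ?B")
proof -
  let ?m = "Suc n"
  have less: "\<forall>a\<in>set \<sigma>. a < ?m" if "\<sigma> \<in> stirling_perms k n" for \<sigma>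
    using set_stirling_perms[OF that] by auto
  \<comment> \<open>The inverse deletes all copies of \<open>Suc n\<close> and takes the length of
    the prefix before the first copy as the place; \<open>k \<ge> 1\<close> ensures that a copy
    exists.\<close>
  have "inj_on ?f ?A"
  proof (rule inj_on_inverseI)
    fix z assume "z \<in> ?A"
    then obtain \<sigma> i where z: "z = (\<sigma>, i)" "\<sigma> \<in> stirling_perms k n" "i \<le> length \<sigma>" by auto
    have ne: "\<forall>a\<in>set (take i \<sigma>). a \<noteq> ?m" "\<forall>a\<in>set (drop i \<sigma>). a \<noteq> ?m"
      using less[OF z(2)] by (auto dest: in_set_takeD in_set_dropD)
    obtain k' where k': "k = Suc k'" using assms by (cases k) auto
    have "filter (\<lambda>a. a \<noteq> ?m) (?f z) = take i \<sigma> @ drop i \<sigma>"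
      using ne by (simp add: z filter_id_conv)
    moreover have "takeWhile (\<lambda>a. a \<noteq> ?m) (?f z) = take i \<sigma>"
      using ne by (simp add: z k')
    ultimately show "(\<lambda>\<tau>. (filter (\<lambda>a. a \<noteq> ?m) \<tau>, length (takeWhile (\<lambda>a. a \<noteq> ?m) \<tau>))) (?f z) = z"
      using z by simp
  qed
  moreover have "?f z \<in> ?B" if "z \<in> ?A" for z
  proof -
    from that obtain \<sigma> i where z: "z = (\<sigma>, i)" "\<sigma> \<in> stirling_perms k n" by auto
    have "mset \<sigma> = mset (take i \<sigma>) + mset (drop i \<sigma>)"
      by (metis append_take_drop_id mset_append)
    moreover have "\<forall>a\<in>set (take i \<sigma>) \<union> set (drop i \<sigma>). a < ?m"
      using less[OF z(2)] by (auto dest: in_set_takeD in_set_dropD)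
    ultimately show ?thesis
      using z stirling_factor_insert_block[of "take i \<sigma>" "drop i \<sigma>" ?m k]
      by (simp add: stirling_perms_iff)
  qed
  moreover have "\<tau> \<in> ?f ` ?A" if \<tau>: "\<tau> \<in> ?B" for \<tau>
  proof -
    \<comment> \<open>The word is cut before the first copy of \<open>?m\<close> and after the run
      \<open>us\<close> of copies starting there.\<close>
    define xs where "xs = takeWhile (\<lambda>a. a \<noteq> ?m) \<tau>"
    define rest where "rest = dropWhile (\<lambda>a. a \<noteq> ?m) \<tau>"
    define us where "us = takeWhile (\<lambda>a. a = ?m) rest"
    define ys where "ys = dropWhile (\<lambda>a. a = ?m) rest"
    have \<tau>_eq: "\<tau> = xs @ us @ ys" by (simp add: xs_def us_def ys_def rest_def)
    have c: "count (mset \<tau>) ?m = k" using count_stirling_perms[OF \<tau>] by simp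
    have xs: "?m \<notin> set xs" unfolding xs_def by (auto dest: set_takeWhileD)
    have us: "us = replicate (length us) ?m"
      by (rule replicate_eqI) (auto simp: us_def dest: set_takeWhileD)
    have "?m \<in> set \<tau>" using c assms by (metis count_mset_0_iff not_one_le_zero)
    then have "rest \<noteq> []" by (auto simp: rest_def dropWhile_eq_Nil_conv)
    then have "hd rest = ?m" unfolding rest_def using hd_dropWhile by blast
    then have "us \<noteq> []" using \<open>rest \<noteq> []\<close> by (cases rest) (auto simp: us_def)
    then have m_us: "?m \<in> set us" using us in_set_replicate[of ?m "length us" ?m] by simp
    have le: "\<forall>a\<in>set \<tau>. a \<le> ?m" using set_stirling_perms[OF \<tau>] by auto
    \<comment> \<open>Otherwise the first letter of \<open>ys\<close>, which is not
      \<open>?m\<close>, would lie between two copies of the largest letter and so be at least as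
      large.\<close>
    have ys: "?m \<notin> set ys"
    proof
      assume m: "?m \<in> set ys"
      then obtain b zs where b: "ys = b # zs" by (cases ys) auto
      then have "b \<noteq> ?m" unfolding ys_def by (metis (full_types) hd_dropWhile list.distinct(1) list.sel(1))
      moreover have "?m \<le> b"
        using \<tau> m_us m b \<open>b \<noteq> ?m\<close>
        by (auto simp: stirling_perms_iff \<tau>_eq stirling_factor_append)
      moreover have "b \<le> ?m" using le by (simp add: \<tau>_eq b)
      ultimately show False by simp
    qed
    have "count (mset us) ?m = length us" by (subst us) simp
    moreover have "count (mset xs) ?m = 0" "count (mset ys) ?m = 0" using xs ys by simp_all
    ultimately have "length us = k" using c by (simp only: \<tau>_eq mset_append count_union)
    then have \<tau>': "\<tau> = xs @ replicate k ?m @ ys" using us \<tau>_eq by simp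
    have "\<forall>a\<in>set xs \<union> set ys. a < ?m"
      using le xs ys by (auto simp: \<tau>_eq le_less)
    then have "xs @ ys \<in> stirling_perms k n"
      using \<tau> stirling_factor_insert_block[of xs ys ?m k]
      by (simp add: stirling_perms_iff \<tau>')
    then show ?thesis using \<tau>' by (intro image_eqI[of _ _ "(xs @ ys, length xs)"]) auto
  qed
  ultimately show ?thesis unfolding bij_betw_def by blast
qed

section \<open>Weights of Stirling permutations as products over gaps\<close>

text \<open>The index of the variable contributed by the gap between positions \<open>i\<close> and \<open>i + 1\<close>
  of the bordered word \<open>w\<close>.\<close>

definition gap_var :: "nat \<Rightarrow> nat list \<Rightarrow> nat \<Rightarrow> nat" where
  "gap_var k w i =
     (if w ! i < w ! Suc i then k + 1 else if w ! Suc i < w ! i then k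
      else Suc (count_list (take i w) (w ! i)))"

text \<open>One factor per gap instead of powers of statistics, so that insertions can be followed
  factor by factor and the Leibniz rule applies.\<close>

definition word_weight :: "nat \<Rightarrow> (nat \<Rightarrow> 'a::comm_ring_1) \<Rightarrow> nat list \<Rightarrow> 'a" where
  "word_weight k x \<sigma> = (\<Prod>i\<le>length \<sigma>. x (gap_var k (0 # \<sigma> @ [0]) i))"

lemma count_list_take_card:
  assumes "i \<le> length xs"
  shows "count_list (take i xs) c = card {l. l < i \<and> xs ! l = c}"
proof -
  have "count_list (take i xs) c = card {l. l < length (take i xs) \<and> take i xs ! l = c}"
    by (simp add: count_list_eq_length_filter length_filter_conv_card eq_commute)
  also have "{l. l < length (take i xs) \<and> take i xs ! l = c} = {l. l < i \<and> xs ! l = c}"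
    using assms by auto
  finally show ?thesis .
qed

text \<open>At a plateau the letter occurs twice besides the copies already counted, and at most
  \<open>k\<close> times in all. Plateaus thus never take the values \<open>k\<close> and
  \<open>k + 1\<close> of descents and ascents.\<close>

lemma gap_var_plateau_less:
  assumes \<sigma>: "\<sigma> \<in> stirling_perms k n" and "\<sigma> \<noteq> []" and i: "i \<le> length \<sigma>"
    and eq: "(0 # \<sigma> @ [0]) ! i = (0 # \<sigma> @ [0]) ! Suc i"
  shows "gap_var k (0 # \<sigma> @ [0]) i < k"
proof -
  let ?w = "0 # \<sigma> @ [0]"
  define c where "c = ?w ! i"
  have pos: "a > 0" if "a \<in> set \<sigma>" for a using set_stirling_perms[OF \<sigma>] that by fastforce
  \<comment> \<open>The letters of \<open>\<sigma>\<close> are positive, so adjacent zeros would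
    require the empty word.\<close>
  have "c \<noteq> 0"
  proof (cases "i = length \<sigma>")
    case True
    then have "c = last \<sigma>" using \<open>\<sigma> \<noteq> []\<close>
      by (simp add: c_def nth_Cons' nth_append last_conv_nth)
    then show ?thesis using pos[of "last \<sigma>"] \<open>\<sigma> \<noteq> []\<close> by simp
  next
    case False
    then have "c = \<sigma> ! i" using i eq by (simp add: c_def nth_append)
    then show ?thesis using pos[of "\<sigma> ! i"] i False by simp
  qed
  have "?w = take i ?w @ ?w ! i # ?w ! Suc i # drop (Suc (Suc i)) ?w"
    using i by (metis Cons_nth_drop_Suc Suc_leI append_take_drop_id length_Cons length_append_singleton
        le_imp_less_Suc lessI less_SucI not_less_eq)
  then have "count_list ?w c = count_list (take i ?w @ c # c # drop (Suc (Suc i)) ?w) c"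
    using eq unfolding c_def by metis
  then have "count_list ?w c \<ge> count_list (take i ?w) c + 2" by simp
  moreover have "count_list ?w c = count (mset \<sigma>) c"
    using \<open>c \<noteq> 0\<close> by (simp add: count_mset count_list_eq_length_filter)
  moreover have "count (mset \<sigma>) c \<le> k" using count_stirling_perms[OF \<sigma>, of c] by auto
  ultimately show ?thesis using eq by (simp add: gap_var_def c_def)
qed

text \<open>The gaps are grouped by the value of \<open>gap_var\<close>; since plateau values stay
  below \<open>k\<close>, the groups are exactly those counted by \<open>plat j\<close>,
  \<open>des\<close> and \<open>asc\<close>.\<close>

lemma word_weight_stirling:
  assumes \<sigma>: "\<sigma> \<in> stirling_perms k n" and "\<sigma> \<noteq> []" and k: "k \<ge> 1"
  shows "(\<Prod>j\<in>{1..k - 1}. x j ^ plat j \<sigma>) * x k ^ des \<sigma> * x (k + 1) ^ asc \<sigma> = word_weight k x \<sigma>"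
proof -
  let ?w = "0 # \<sigma> @ [0]"
  let ?g = "gap_var k ?w"
  let ?I = "\<lambda>j. {i \<in> {..length \<sigma>}. ?g i = j}"
  have lt: "?g i < k" if "i \<le> length \<sigma>" "?w ! i = ?w ! Suc i" for i
    using gap_var_plateau_less[OF assms(1,2)] that by blast
  have range: "?g ` {..length \<sigma>} \<subseteq> {1..k + 1}"
  proof safe
    fix i assume "i \<le> length \<sigma>"
    then show "?g i \<in> {1..k + 1}"
      using lt[of i] k by (cases "?w ! i = ?w ! Suc i") (auto simp: gap_var_def)
  qed
  have up: "?g i = k + 1 \<longleftrightarrow> ?w ! i < ?w ! (i + 1)" if "i \<le> length \<sigma>" for i
    using lt[OF that] by (cases "?w ! i" "?w ! Suc i" rule: linorder_cases) (simp_all add: gap_var_def)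
  have down: "?g i = k \<longleftrightarrow> ?w ! i > ?w ! (i + 1)" if "i \<le> length \<sigma>" for i
    using lt[OF that] by (cases "?w ! i" "?w ! Suc i" rule: linorder_cases) (simp_all add: gap_var_def)
  have asc: "asc \<sigma> = card (?I (k + 1))"
    unfolding asc_def entry_def
    by (rule arg_cong[where f = card]) (use up in auto)
  have des: "des \<sigma> = card (?I k)"
    unfolding des_def entry_def
    by (rule arg_cong[where f = card]) (use down in auto)
  have plat: "plat j \<sigma> = card (?I j)" if j: "j \<in> {1..k - 1}" for j
  proof -
    have "(?g i = j) = (?w ! i = ?w ! (i + 1) \<and> card {l. l < i \<and> ?w ! l = ?w ! i} = j - 1)"
      if "i \<le> length \<sigma>" for i
      using j that count_list_take_card[of i ?w "?w ! i"] by (auto simp: gap_var_def)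
    then show ?thesis unfolding plat_def entry_def by (intro arg_cong[where f = card]) auto
  qed
  have "word_weight k x \<sigma> = (\<Prod>j\<in>{1..k + 1}. \<Prod>i\<in>?I j. x (?g i))"
    unfolding word_weight_def by (rule prod.group[symmetric]) (use range in auto)
  also have "\<dots> = (\<Prod>j\<in>{1..k + 1}. x j ^ card (?I j))"
    by (intro prod.cong refl) simp
  also have "{1..k + 1} = insert (k + 1) (insert k {1..k - 1})" using k by auto
  also have "(\<Prod>j\<in>\<dots>. x j ^ card (?I j)) =
      (\<Prod>j\<in>{1..k - 1}. x j ^ card (?I j)) * x k ^ card (?I k) * x (k + 1) ^ card (?I (k + 1))"
    using k by (simp add: mult_ac)
  finally show ?thesis using plat asc des by simp
qed

text \<open>The gap at \<open>length xs\<close> splits into \<open>k + 1\<close> gaps: an ascent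
  into the block, plateaus with values 1 to \<open>k - 1\<close>, and a descent out of it. All other
  gaps keep their values.\<close>

lemma word_weight_insert_block:
  fixes x :: "nat \<Rightarrow> 'a::comm_ring_1"
  assumes less: "\<forall>a\<in>set xs \<union> set ys. a < m" and "0 < m" and k: "k \<ge> 1"
  shows "word_weight k x (xs @ replicate k m @ ys) =
    (\<Prod>j\<in>{1..k + 1}. x j) *
    (\<Prod>i\<in>{..length (xs @ ys)} - {length xs}. x (gap_var k (0 # xs @ ys @ [0]) i))"
proof -
  define u where "u = 0 # xs"
  define v where "v = ys @ [0]"
  define p where "p = length xs"
  define q where "q = length ys"
  define w where "w = u @ v"
  define w' where "w' = u @ replicate k m @ v"
  have len: "length u = Suc p" "length v = Suc q" by (simp_all add: u_def v_def p_def q_def)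
  have u: "\<forall>a\<in>set u. a < m" and v: "\<forall>a\<in>set v. a < m"
    using less \<open>0 < m\<close> by (auto simp: u_def v_def)
  have ucnt: "count_list u m = 0" using u by (auto simp: count_list_0_iff)
  have left: "gap_var k w' i = gap_var k w i" if "i < p" for i
    using that len by (simp add: gap_var_def w_def w'_def nth_append)
  have right: "gap_var k w' (i + k) = gap_var k w i" if "p < i" "i \<le> p + q" for i
  proof -
    obtain d where d: "i = Suc p + d" using \<open>p < i\<close> by (metis less_iff_Suc_add add_Suc)
    have dq: "d < q" using d that by simp
    have nth: "w' ! (i + k) = v ! d" "w' ! Suc (i + k) = v ! Suc d" "w ! i = v ! d" "w ! Suc i = v ! Suc d"
      using len by (simp_all add: w_def w'_def d nth_append)
    \<comment> \<open>The inserted copies of \<open>m\<close> do not alter the number of earlier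
      occurrences of a smaller letter.\<close>
    have "v ! d \<noteq> m" using v dq len nth_mem[of d v] by fastforce
    then have "v ! d \<notin> set (replicate k m)" by auto
    then have "count_list (replicate k m) (v ! d) = 0" by (rule count_notin)
    moreover have "take (i + k) w' = u @ replicate k m @ take d v" "take i w = u @ take d v"
      using len by (simp_all add: w_def w'_def d)
    ultimately show ?thesis by (simp only: gap_var_def nth count_list_append add_0)
  qed
  have mid0: "gap_var k w' p = k + 1"
  proof -
    have "w' ! p = u ! p" "w' ! Suc p = m" using len k by (simp_all add: w'_def nth_append)
    moreover have "u ! p < m" using u len by simp
    ultimately show ?thesis by (simp add: gap_var_def)
  qed
  \<comment> \<open>Position \<open>p + t\<close> of \<open>w'\<close> holds the \<open>t\<close>-th
    copy of \<open>m\<close>; the gap after it is a plateau for \<open>t < k\<close> and the descent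
    for \<open>t = k\<close>.\<close>
  have mid: "gap_var k w' (p + t) = t" if "1 \<le> t" "t \<le> k" for t
  proof -
    have "t - 1 < k" using that by linarith
    then have t1: "w' ! (p + t) = m" using len that by (simp add: w'_def nth_append)
    show ?thesis
    proof (cases "t = k")
      case True
      have "w' ! Suc (p + t) = v ! 0" using len by (simp add: True w'_def nth_append)
      moreover have "v ! 0 < m" using v len by simp
      ultimately show ?thesis using t1 True by (simp add: gap_var_def)
    next
      case False
      then have "w' ! Suc (p + t) = m" using len that by (simp add: w'_def nth_append)
      moreover have "take (p + t) w' = u @ replicate (t - 1) m"
        using len that by (simp add: w'_def min_def)
      moreover have "count_list (replicate (t - 1) m) m = t - 1"
        by (simp add: count_list_eq_length_filter)
      ultimately show ?thesis using t1 ucnt that by (simp add: gap_var_def)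
    qed
  qed
  let ?h = "\<lambda>i. x (gap_var k w i)" and ?h' = "\<lambda>i. x (gap_var k w' i)"
  have "word_weight k x (xs @ replicate k m @ ys) = prod ?h' {..p + k + q}"
    by (simp add: word_weight_def w'_def u_def v_def p_def q_def add_ac)
  \<comment> \<open>Old gaps on the left, the \<open>k + 1\<close> gaps replacing gap
    \<open>p\<close>, and old gaps on the right shifted by \<open>k\<close>.\<close>
  also have "{..p + k + q} = {..<p} \<union> ((\<lambda>t. p + t) ` {..k} \<union> (\<lambda>i. i + k) ` {p<..p + q})"
  proof -
    have "i \<in> {..<p} \<union> ((\<lambda>t. p + t) ` {..k} \<union> (\<lambda>i. i + k) ` {p<..p + q})"
      if "i \<le> p + k + q" for i
    proof -
      consider "i < p" | "p \<le> i" "i \<le> p + k" | "p + k < i" by linarith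
      then show ?thesis
      proof cases
        case 2
        then have "i = p + (i - p)" "i - p \<in> {..k}" by auto
        then show ?thesis by blast
      next
        case 3
        then have "i = (i - k) + k" "i - k \<in> {p<..p + q}" using that by auto
        then show ?thesis by blast
      qed simp
    qed
    then show ?thesis by auto
  qed
  also have "prod ?h' \<dots> = prod ?h' {..<p} *
      (prod ?h' ((\<lambda>t. p + t) ` {..k}) * prod ?h' ((\<lambda>i. i + k) ` {p<..p + q}))"
    by (subst prod.union_disjoint, auto)+
  also have "prod ?h' {..<p} = prod ?h {..<p}" by (intro prod.cong) (simp_all add: left)
  also have "prod ?h' ((\<lambda>i. i + k) ` {p<..p + q}) = prod ?h {p<..p + q}"
    by (subst prod.reindex) (simp_all add: right)
  also have "prod ?h' ((\<lambda>t. p + t) ` {..k}) = (\<Prod>t\<in>{..k}. ?h' (p + t))"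
    by (subst prod.reindex) simp_all
  also have "\<dots> = (\<Prod>j\<in>{1..k + 1}. x j)"
  proof -
    have "{..k} = insert 0 {1..k}" "{1..k + 1} = insert (k + 1) {1..k}" by auto
    then show ?thesis by (simp add: mid0 mid)
  qed
  also have "prod ?h {..<p} * ((\<Prod>j\<in>{1..k + 1}. x j) * prod ?h {p<..p + q}) =
      (\<Prod>j\<in>{1..k + 1}. x j) * (prod ?h {..<p} * prod ?h {p<..p + q})"
    by (simp only: mult_ac)
  also have "prod ?h {..<p} * prod ?h {p<..p + q} = prod ?h ({..<p} \<union> {p<..p + q})"
    by (rule prod.union_disjoint[symmetric]) auto
  also have "{..<p} \<union> {p<..p + q} = {..length (xs @ ys)} - {length xs}"
    by (auto simp: p_def q_def)
  finally show ?thesis by (simp add: w_def u_def v_def)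
qed

text \<open>The inner sum is the Leibniz expansion of the derivative of \<open>word_weight\<close>.
  Writing it without derivatives covers every commutative ring, and \<open>n = 0\<close> as
  well.\<close>

lemma stirling_poly_insert_block:
  fixes x :: "nat \<Rightarrow> 'a::comm_ring_1"
  assumes k: "k \<ge> 1"
  shows "stirling_poly k (Suc n) x = (\<Prod>j\<in>{1..k + 1}. x j) *
    (\<Sum>\<sigma>\<in>stirling_perms k n. \<Sum>i\<le>length \<sigma>.
       \<Prod>l\<in>{..length \<sigma>} - {i}. x (gap_var k (0 # \<sigma> @ [0]) l))"
proof -
  have ne: "\<sigma> \<noteq> []" if "\<sigma> \<in> stirling_perms k (Suc n)" for \<sigma>
    using count_stirling_perms[OF that, of 1] k by auto
  have "stirling_poly k (Suc n) x = (\<Sum>\<tau>\<in>stirling_perms k (Suc n). word_weight k x \<tau>)"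
    unfolding stirling_poly_def using word_weight_stirling ne k by (intro sum.cong refl) blast
  also have "\<dots> = (\<Sum>(\<sigma>, i)\<in>(SIGMA \<sigma>:stirling_perms k n. {..length \<sigma>}).
      word_weight k x (take i \<sigma> @ replicate k (Suc n) @ drop i \<sigma>))"
    using sum.reindex_bij_betw[OF bij_betw_insert_block[OF k, of n], of "word_weight k x"]
    by (simp add: case_prod_unfold)
  also have "\<dots> = (\<Sum>\<sigma>\<in>stirling_perms k n. \<Sum>i\<le>length \<sigma>.
      word_weight k x (take i \<sigma> @ replicate k (Suc n) @ drop i \<sigma>))"
    by (rule sum.Sigma[symmetric]) (auto simp: finite_stirling_perms)
  also have "\<dots> = (\<Sum>\<sigma>\<in>stirling_perms k n. \<Sum>i\<le>length \<sigma>. (\<Prod>j\<in>{1..k + 1}. x j) *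
       (\<Prod>l\<in>{..length \<sigma>} - {i}. x (gap_var k (0 # \<sigma> @ [0]) l)))"
  proof (intro sum.cong refl)
    fix \<sigma> i assume \<sigma>: "\<sigma> \<in> stirling_perms k n" and i: "i \<in> {..length \<sigma>}"
    have "\<forall>a\<in>set (take i \<sigma>) \<union> set (drop i \<sigma>). a < Suc n"
      using set_stirling_perms[OF \<sigma>] by (fastforce dest: in_set_takeD in_set_dropD)
    moreover have "take i \<sigma> @ drop i \<sigma> @ [0] = \<sigma> @ [0]"
      by (simp only: append_assoc[symmetric] append_take_drop_id)
    moreover have "length (take i \<sigma>) = i" using i by simp
    ultimately show "word_weight k x (take i \<sigma> @ replicate k (Suc n) @ drop i \<sigma>) =
        (\<Prod>j\<in>{1..k + 1}. x j) * (\<Prod>l\<in>{..length \<sigma>} - {i}. x (gap_var k (0 # \<sigma> @ [0]) l))"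
      using word_weight_insert_block[of "take i \<sigma>" "drop i \<sigma>" "Suc n" k x] k
      by (simp only: append_take_drop_id zero_less_Suc simp_thms)
  qed
  finally show ?thesis by (simp only: sum_distrib_left)
qed

lemma stirling_poly_1:
  assumes "k \<ge> 1"
  shows "stirling_poly k 1 x = (\<Prod>j\<in>{1..k + 1}. x j)"
proof -
  have "stirling_perms k 0 = {[]}" by (auto simp: stirling_perms_def)
  \<comment> \<open>The empty word has a single gap, and omitting it leaves an empty
    product.\<close>
  then show ?thesis using stirling_poly_insert_block[OF assms, of 0 x] by simp
qed

lemma stirling_poly_Suc:
  fixes X :: "nat \<Rightarrow> 'a::comm_ring_1 fps"
  assumes X: "\<And>j. fps_deriv (X j) = 1" and n: "n \<ge> 1" and k: "k \<ge> 1"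
  shows "stirling_poly k (Suc n) X = (\<Prod>j\<in>{1..k + 1}. X j) * fps_deriv (stirling_poly k n X)"
proof -
  have ne: "\<sigma> \<noteq> []" if "\<sigma> \<in> stirling_perms k n" for \<sigma>
    using count_stirling_perms[OF that, of 1] k n by auto
  have "stirling_poly k n X = (\<Sum>\<sigma>\<in>stirling_perms k n. word_weight k X \<sigma>)"
    unfolding stirling_poly_def using word_weight_stirling ne k by (intro sum.cong refl) blast
  then have "fps_deriv (stirling_poly k n X) = (\<Sum>\<sigma>\<in>stirling_perms k n. \<Sum>i\<le>length \<sigma>.
       \<Prod>l\<in>{..length \<sigma>} - {i}. X (gap_var k (0 # \<sigma> @ [0]) l))"
    by (simp add: fps_deriv_sum word_weight_def fps_deriv_prod X)
  then show ?thesis using stirling_poly_insert_block[OF k, of n X] by simp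
qed

subsection \<open>Expansion in elementary symmetric functions\<close>

lemma stirling_poly_eq_tree_poly_fps:
  fixes X :: "nat \<Rightarrow> 'a::comm_ring_1 fps"
  assumes X: "\<And>j. fps_deriv (X j) = 1" and "n \<ge> 1" and k: "k \<ge> 1"
  shows "stirling_poly k n X = tree_poly k n X"
  using \<open>n \<ge> 1\<close>
proof (induction n rule: dec_induct)
  case base
  show ?case by (simp only: stirling_poly_1[OF k] tree_poly_1 vertex_weight_0)
next
  case (step n)
  then show ?case
    using stirling_poly_Suc[OF X _ k, of n] tree_poly_Suc[OF X, of n k] vertex_weight_0[of k X] by simp
qed

section \<open>Transfer from power series to an arbitrary commutative ring\<close>

lemma fps_nth_0_prod: "fps_nth (prod f A) 0 = (\<Prod>a\<in>A. fps_nth (f a) 0)"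
  for f :: "'b \<Rightarrow> 'a::comm_ring_1 fps"
  by (induction A rule: infinite_finite_induct) auto

lemma fps_nth_0_prod_list: "fps_nth (prod_list fs) 0 = prod_list (map (\<lambda>f. fps_nth f 0) fs)"
  for fs :: "'a::comm_ring_1 fps list"
  by (induction fs) auto

lemma fps_nth_0_power: "fps_nth (f ^ n) 0 = fps_nth f 0 ^ n"
  for f :: "'a::comm_ring_1 fps"
  by (induction n) auto

lemma fps_nth_0_stirling_poly:
  "fps_nth (stirling_poly k n X) 0 = stirling_poly k n (\<lambda>j. fps_nth (X j) 0)"
  by (simp add: stirling_poly_def fps_sum_nth fps_nth_0_prod fps_nth_0_power)

lemma fps_nth_0_tree_poly:
  "fps_nth (tree_poly k n X) 0 = tree_poly k n (\<lambda>j. fps_nth (X j) 0)"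
proof -
  have "fps_nth (vertex_weight k X d) 0 = vertex_weight k (\<lambda>j. fps_nth (X j) 0) d" for d
    by (simp add: vertex_weight_def elem_sym_def fps_sum_nth fps_nth_0_prod)
  then show ?thesis
    by (simp add: tree_poly_def tree_weight_def fps_sum_nth fps_nth_0_prod_list o_def)
qed

text \<open>Taking constant coefficients respects sums and products, so it carries the identity at
  the points \<open>x j + t\<close> back to the points \<open>x j\<close>.\<close>

lemma stirling_poly_eq_tree_poly:
  fixes x :: "nat \<Rightarrow> 'a::comm_ring_1"
  assumes "n \<ge> 1" and "k \<ge> 1"
  shows "stirling_poly k n x = tree_poly k n x"
proof -
  define X where "X j = fps_const (x j) + fps_X" for j
  have "stirling_poly k n X = tree_poly k n X"
    using assms by (intro stirling_poly_eq_tree_poly_fps) (simp_all add: X_def)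
  then have "fps_nth (stirling_poly k n X) 0 = fps_nth (tree_poly k n X) 0" by simp
  moreover have "(\<lambda>j. fps_nth (X j) 0) = x" by (simp add: X_def)
  ultimately show ?thesis by (simp add: fps_nth_0_stirling_poly fps_nth_0_tree_poly)
qed

section \<open>Degree sequences of trees and the index set\<close>

lemma length_degrees: "length (degrees t) = length (labels t)"
  by (induction t) (auto simp: length_concat o_def intro!: arg_cong[where f = sum_list])

text \<open>Each vertex other than the root is counted once, as a child of its parent.\<close>

lemma Suc_sum_list_degrees: "Suc (sum_list (degrees t)) = length (degrees t)"
proof (induction t)
  case (Node a ts)
  then have "(\<Sum>t\<leftarrow>ts. Suc (sum_list (degrees t))) = (\<Sum>t\<leftarrow>ts. length (degrees t))"
    by (intro arg_cong[where f = sum_list] map_cong) auto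
  moreover have "(\<Sum>t\<leftarrow>ts. Suc (sum_list (degrees t))) = length ts + (\<Sum>t\<leftarrow>ts. sum_list (degrees t))"
    by (induction ts) auto
  moreover have "sum_list (concat (map degrees ts)) = (\<Sum>t\<leftarrow>ts. sum_list (degrees t))"
    by (induction ts) auto
  ultimately show ?case by (simp add: length_concat o_def)
qed

lemma sum_count_list:
  "finite A \<Longrightarrow> set xs \<subseteq> A \<Longrightarrow> (\<Sum>a\<in>A. count_list xs a) = length xs"
proof (induction xs)
  case (Cons b xs)
  have "count_list (b # xs) a = (if b = a then 1 else 0) + count_list xs a" for a
    by simp
  then show ?case using Cons by (simp add: sum.distrib del: count_list.simps)
qed simp

lemma prod_count_list:
  fixes f :: "'b \<Rightarrow> 'a::comm_monoid_mult"
  shows "finite A \<Longrightarrow> set xs \<subseteq> A \<Longrightarrow> (\<Prod>a\<in>A. f a ^ count_list xs a) = prod_list (map f xs)"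
proof (induction xs)
  case (Cons b xs)
  have *: "f a ^ count_list (b # xs) a = (if b = a then f a else 1) * f a ^ count_list xs a" for a
    by simp
  show ?case using Cons by (simp add: * prod.distrib del: count_list.simps)
qed simp

text \<open>Some degree is zero because \<open>n\<close> degrees have sum \<open>n - 1\<close>; not
  all are zero because this sum is positive; and a degree \<open>n - 1\<close> uses up the whole
  sum, so the other degrees vanish.\<close>

lemma degree_count_in_gamma_index:
  assumes n: "n \<ge> 2" and len: "length ds = n" and sum: "Suc (sum_list ds) = n"
  shows "(\<lambda>j\<in>{1..n}. count_list ds (j - 1)) \<in> gamma_index n"
proof -
  have le: "d < n" if "d \<in> set ds" for d using member_le_sum_list[OF that] sum by simp
  have "(\<Sum>j\<in>{1..n}. count_list ds (j - 1)) = (\<Sum>d\<in>{..<n}. count_list ds d)"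
    by (rule sum.reindex_bij_witness[of _ Suc "\<lambda>j. j - 1"]) auto
  also have "\<dots> = n" using sum_count_list[of "{..<n}" ds] le len by auto
  finally have tot: "(\<Sum>j\<in>{1..n}. count_list ds (j - 1)) = n" .
  have "0 \<in> set ds"
  proof (rule ccontr)
    assume "0 \<notin> set ds"
    then have "length ds \<le> sum_list ds" by (induction ds) (auto simp: Suc_le_eq)
    then show False using len sum by simp
  qed
  then have pos: "1 \<le> count_list ds 0"
    by (metis count_list_0_iff less_one not_le)
  have not_all: "count_list ds 0 \<le> n - 1"
  proof (rule ccontr)
    assume "\<not> count_list ds 0 \<le> n - 1"
    then have "length (filter ((=) 0) ds) = length ds"
      using count_le_length[of ds 0] len by (simp add: count_list_eq_length_filter)
    then have "d = 0" if "d \<in> set ds" for d using length_filter_less[OF that, of "(=) 0"] by auto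
    then have "sum_list ds = 0" by simp
    then show False using sum n by linarith
  qed
  have top: "count_list ds (n - 1) = 1 \<and> count_list ds 0 = n - 1" if "count_list ds (n - 1) \<noteq> 0"
  proof -
    have "n - 1 \<in> set ds" using that by (metis count_list_0_iff)
    then obtain us vs where ds: "ds = us @ (n - 1) # vs" by (meson split_list)
    then have "sum_list us + (n - 1) + sum_list vs = n - 1" using sum by simp
    then have "sum_list us = 0" "sum_list vs = 0" by linarith+
    then have "\<forall>d\<in>set (us @ vs). d = 0" by auto
    then have "us @ vs = replicate (length (us @ vs)) 0" by (meson replicate_eqI)
    then have "us @ vs = replicate (n - 1) 0" using len ds by simp
    then have cnt: "count_list us c + count_list vs c = (if c = 0 then n - 1 else 0)" for c
      by (subst count_list_append[symmetric]) (simp add: count_list_eq_length_filter del: filter_append)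
    show ?thesis using n cnt[of 0] cnt[of "n - 1"] by (simp add: ds)
  qed
  show ?thesis
    using n tot pos not_all top unfolding gamma_index_def by auto
qed

lemma finite_gamma_index: "finite (gamma_index n)"
proof (rule finite_subset)
  show "gamma_index n \<subseteq> {1..n} \<rightarrow>\<^sub>E {..n}"
  proof
    fix i assume i: "i \<in> gamma_index n"
    have "i j \<le> n" if "j \<in> {1..n}" for j
      using member_le_sum[of j "{1..n}" i] i that by (auto simp: gamma_index_def)
    then show "i \<in> {1..n} \<rightarrow>\<^sub>E {..n}" using i by (auto simp: gamma_index_def PiE_iff)
  qed
qed (simp add: finite_PiE)

text \<open>Trees are grouped by their degree counts, which determine the weight. All degrees are at
  most \<open>n - 1\<close>, hence at most \<open>k + 1\<close>, so the degree bound holds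
  automatically.\<close>

theorem theorem4p8:
  fixes n k :: nat and x :: "nat \<Rightarrow> 'a::comm_ring_1"
  assumes "n \<ge> 2" and "k \<ge> 1" and "k \<ge> n - 2"
  shows "stirling_poly k n x =
    (\<Sum>i\<in>gamma_index n.
       of_nat (tree_gamma k n i) * (\<Prod>j\<in>{1..n}. elem_sym (k + 1) (k + 2 - j) x ^ i j))"
proof -
  let ?T = "{t. increasing_plane_tree n t}"
  \<comment> \<open>Restricting to \<open>{1..n}\<close> matches the extensional functions in
    \<open>gamma_index n\<close>; index \<open>j\<close> stands for degree
    \<open>j - 1\<close>.\<close>
  let ?ix = "\<lambda>t. \<lambda>j\<in>{1..n}. count_list (degrees t) (j - 1)"
  let ?e = "\<lambda>i. \<Prod>j\<in>{1..n}. elem_sym (k + 1) (k + 2 - j) x ^ i j"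
  have len: "length (degrees t) = n" "Suc (sum_list (degrees t)) = n" if "t \<in> ?T" for t
  proof -
    have "distinct (labels t)" "set (labels t) = {1..n}"
      using that by (simp_all add: increasing_plane_tree_def)
    then show "length (degrees t) = n"
      using distinct_card[of "labels t"] by (simp add: length_degrees)
    then show "Suc (sum_list (degrees t)) = n" by (simp add: Suc_sum_list_degrees)
  qed
  have lt: "d < n" if "t \<in> ?T" "d \<in> set (degrees t)" for t d
    using member_le_sum_list[OF that(2)] len[OF that(1)] by simp
  have weight: "tree_weight k x t = ?e (?ix t)" if t: "t \<in> ?T" for t
  proof -
    have "tree_weight k x t = (\<Prod>d\<in>{..<n}. vertex_weight k x d ^ count_list (degrees t) d)"
      unfolding tree_weight_def by (rule prod_count_list[symmetric]) (use lt[OF t] in auto)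
    also have "\<dots> = (\<Prod>j\<in>{1..n}. vertex_weight k x (j - 1) ^ count_list (degrees t) (j - 1))"
      by (rule prod.reindex_bij_witness[of _ "\<lambda>j. j - 1" Suc]) auto
    also have "\<dots> = ?e (?ix t)"
    proof (intro prod.cong refl)
      fix j assume j: "j \<in> {1..n}"
      \<comment> \<open>By \<open>k \<ge> n - 2\<close> the weight is a genuine elementary symmetric
        function here and no subtraction is truncated.\<close>
      then have "j - 1 \<le> k + 1" "k + 1 - (j - 1) = k + 2 - j" using assms by auto
      then show "vertex_weight k x (j - 1) ^ count_list (degrees t) (j - 1) =
          elem_sym (k + 1) (k + 2 - j) x ^ ?ix t j"
        using j by (simp add: vertex_weight_def)
    qed
    finally show ?thesis .
  qed
  have fiber: "{t \<in> ?T. ?ix t = i} = {t. increasing_plane_tree n t \<and> degree_bounded (k + 1) t \<and>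
      (\<forall>j\<in>{1..n}. count_list (degrees t) (j - 1) = i j)}" if i: "i \<in> gamma_index n" for i
  proof -
    have "degree_bounded (k + 1) t" if "t \<in> ?T" for t
      unfolding degree_bounded_def using lt[OF that] assms(3) by fastforce
    moreover have "?ix t = i \<longleftrightarrow> (\<forall>j\<in>{1..n}. count_list (degrees t) (j - 1) = i j)" for t
    proof -
      have "i \<in> extensional {1..n}" using i by (auto simp: gamma_index_def PiE_def)
      then show ?thesis
        by (metis (no_types, lifting) extensionalityI restrict_apply' restrict_extensional)
    qed
    ultimately show ?thesis by blast
  qed
  have "stirling_poly k n x = (\<Sum>t\<in>?T. tree_weight k x t)"
    using assms by (simp add: stirling_poly_eq_tree_poly tree_poly_def)
  also have "\<dots> = (\<Sum>i\<in>gamma_index n. \<Sum>t\<in>{t \<in> ?T. ?ix t = i}. tree_weight k x t)"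
  proof (rule sum.group[symmetric])
    show "?ix ` ?T \<subseteq> gamma_index n"
      using degree_count_in_gamma_index[OF assms(1)] len by blast
  qed (use assms finite_increasing_plane_tree[of n] finite_gamma_index in auto)
  also have "\<dots> = (\<Sum>i\<in>gamma_index n. of_nat (tree_gamma k n i) * ?e i)"
  proof (intro sum.cong refl)
    fix i assume i: "i \<in> gamma_index n"
    have "(\<Sum>t\<in>{t \<in> ?T. ?ix t = i}. tree_weight k x t) = (\<Sum>t\<in>{t \<in> ?T. ?ix t = i}. ?e i)"
      using weight by (intro sum.cong refl) auto
    also have "\<dots> = of_nat (card {t \<in> ?T. ?ix t = i}) * ?e i" by (rule sum_constant)
    finally show "(\<Sum>t\<in>{t \<in> ?T. ?ix t = i}. tree_weight k x t) = of_nat (tree_gamma k n i) * ?e i"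
      by (simp only: tree_gamma_def fiber[OF i])
  qed
  finally show ?thesis .
qed

end
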